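(* Let $S$ and $S'$ be composition series for the finite groups $G$ and $H$. Then there is a bijection between $\mathrm{Iso}(S, S')$ and $\mathrm{Iso}(X(S), X(S'))$.
   Context: All groups are finite and $n = |G|$. For a composition series $S$ given by $G_0 = 1 \triangleleft \cdots \triangleleft G_m = G$ and a composition series $S'$ given by $H_0 = 1 \triangleleft \cdots \triangleleft H_m = H$, $\mathrm{Iso}(S,S')$ is the set of isomorphisms $\phi : G \to H$ with $\phi[G_i] = H_i$ for all $i$. The tree $T(S)$ has nodes $\bigcup_i G/G_i$ (cosets), root $G$, leaves identified with the elements $x \in G$, and an edge from each $xG_{i+1}$ to each $yG_i \subseteq xG_{i+1}$. The colored graph $X(S)$ is built as follows: take a copy $T_S$ of $T(S)$, and for each $x \in G$ a copy $T_S^{(x)}$ of $T(S)$ whose root is identified with the leaf $x$ of $T_S$; the leaf for $y$ in $T_S^{(x)}$ is denoted $y^{(x)}$. For each $x, y \in G$ attach three new leaves $y_\leftarrow^{(x)}, y_\rightarrow^{(x)}, y_=^{(x)}$ to $y^{(x)}$. For all $x,y,z \in G$ with $xy = z$, add an edge from $y_\leftarrow^{(x)}$ to $x_\rightarrow^{(y)}$ and from $x_\rightarrow^{(y)}$ to $y_=^{(z)}$, coloring $y_\leftarrow^{(x)}$ "left", $x_\rightarrow^{(y)}$ "right", $y_=^{(z)}$ "equal". The root of $T_S$ is colored "root" and all remaining nodes "internal". $\mathrm{Iso}(X(S), X(S'))$ denotes the set of color-preserving graph isomorphisms from $X(S)$ to $X(S')$. *)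

theory Defs
  imports "HOL-Algebra.Left_Coset" "HOL-Algebra.SimpleGroups"
begin

text \<open>A series \<open>G\<^sub>0 = 1 \<lhd> \<dots> \<lhd> G\<^sub>m = G\<close> is the list \<open>[G\<^sub>0, \<dots>, G\<^sub>m]\<close>, of length \<open>m + 1\<close>.\<close>

definition composition_series :: "('a, 'm) monoid_scheme \<Rightarrow> 'a set list \<Rightarrow> bool" where
  "composition_series G S \<longleftrightarrow>
     S \<noteq> [] \<and> hd S = {\<one>\<^bsub>G\<^esub>} \<and> last S = carrier G \<and>
     (\<forall>i. Suc i < length S \<longrightarrow>
        S ! i \<lhd> (G\<lparr>carrier := S ! Suc i\<rparr>) \<and>
        simple_group ((G\<lparr>carrier := S ! Suc i\<rparr>) Mod (S ! i)))"

text \<open>Isomorphisms are taken to be \<^const>\<open>extensional\<close>, so that each map between the carriers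
  is represented by exactly one HOL function. Series of different lengths have no isomorphism.\<close>

definition series_Iso ::
  "('a, 'm) monoid_scheme \<Rightarrow> 'a set list \<Rightarrow> ('b, 'n) monoid_scheme \<Rightarrow> 'b set list \<Rightarrow> ('a \<Rightarrow> 'b) set" where
  "series_Iso G S H S' =
     {\<phi> \<in> iso G H \<inter> extensional (carrier G).
        length S = length S' \<and> (\<forall>i < length S. \<phi> ` (S ! i) = S' ! i)}"

record ('v, 'c) colored_graph =
  verts :: "'v set"
  edges :: "'v set set"
  color :: "'v \<Rightarrow> 'c"

definition graph_Iso ::
  "('v, 'c) colored_graph \<Rightarrow> ('w, 'c) colored_graph \<Rightarrow> ('v \<Rightarrow> 'w) set" where
  "graph_Iso X Y =
     {f \<in> extensional (verts X).
        bij_betw f (verts X) (verts Y) \<and>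
        (\<forall>u \<in> verts X. \<forall>v \<in> verts X. {u, v} \<in> edges X \<longleftrightarrow> {f u, f v} \<in> edges Y) \<and>
        (\<forall>u \<in> verts X. color Y (f u) = color X u)}"

text \<open>The tree \<open>T(S)\<close>: its nodes are left cosets, its root is \<^term>\<open>carrier G\<close>, and the leaf for
  \<open>x\<close> is the coset \<open>{x}\<close> of \<open>G\<^sub>0\<close>. Edges are (parent, child) pairs.\<close>

definition tree_nodes :: "('a, 'm) monoid_scheme \<Rightarrow> 'a set list \<Rightarrow> 'a set set" where
  "tree_nodes G S = (\<Union>i < length S. lcosets\<^bsub>G\<^esub> (S ! i))"

definition tree_edges :: "('a, 'm) monoid_scheme \<Rightarrow> 'a set list \<Rightarrow> ('a set \<times> 'a set) set" where
  "tree_edges G S =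
     {(C, D). \<exists>i. Suc i < length S \<and>
        C \<in> lcosets\<^bsub>G\<^esub> (S ! Suc i) \<and> D \<in> lcosets\<^bsub>G\<^esub> (S ! i) \<and> D \<subseteq> C}"

datatype node_color = Root | Internal | Left | Right | Equal

text \<open>\<open>Main C\<close> is the node \<open>C\<close> of \<open>T\<^sub>S\<close>, and \<open>Copy x C\<close> the node \<open>C\<close> of the copy of \<open>T(S)\<close> attached
  at \<open>x\<close>. \<open>LeftLeaf x y\<close>, \<open>RightLeaf x y\<close>, \<open>EqualLeaf x y\<close> are the three leaves attached to the leaf
  \<open>y\<close> of that copy (superscript \<open>x\<close> first).\<close>

datatype 'a xnode =
    Main "'a set"
  | Copy 'a "'a set"
  | LeftLeaf 'a 'a
  | RightLeaf 'a 'a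
  | EqualLeaf 'a 'a

text \<open>The node \<open>C\<close> of the copy at \<open>x\<close>, after identifying the root of this copy with the leaf
  \<open>{x}\<close> of \<open>T\<^sub>S\<close>; thus \<^term>\<open>Copy x (carrier G)\<close> is never a vertex. If \<open>G\<close> is trivial, the root
  of \<open>T\<^sub>S\<close>, its leaf and the only node of the attached copy all coincide.\<close>

definition copy_node :: "('a, 'm) monoid_scheme \<Rightarrow> 'a \<Rightarrow> 'a set \<Rightarrow> 'a xnode" where
  "copy_node G x C = (if C = carrier G then Main {x} else Copy x C)"

definition X_verts :: "('a, 'm) monoid_scheme \<Rightarrow> 'a set list \<Rightarrow> 'a xnode set" where
  "X_verts G S =
     Main ` tree_nodes G S \<union>
     {copy_node G x C | x C. x \<in> carrier G \<and> C \<in> tree_nodes G S} \<union>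
     (\<Union>x \<in> carrier G. \<Union>y \<in> carrier G. {LeftLeaf x y, RightLeaf x y, EqualLeaf x y})"

definition X_edges :: "('a, 'm) monoid_scheme \<Rightarrow> 'a set list \<Rightarrow> 'a xnode set set" where
  "X_edges G S =
     {{Main C, Main D} | C D. (C, D) \<in> tree_edges G S} \<union>
     {{copy_node G x C, copy_node G x D} | x C D. x \<in> carrier G \<and> (C, D) \<in> tree_edges G S} \<union>
     (\<Union>x \<in> carrier G. \<Union>y \<in> carrier G.
        {{copy_node G x {y}, LeftLeaf x y},
         {copy_node G x {y}, RightLeaf x y},
         {copy_node G x {y}, EqualLeaf x y}}) \<union>
     (\<Union>x \<in> carrier G. \<Union>y \<in> carrier G.
        {{LeftLeaf x y, RightLeaf y x},
         {RightLeaf y x, EqualLeaf (x \<otimes>\<^bsub>G\<^esub> y) y}})"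

text \<open>Every attached leaf lies on one of the edges given by a product \<open>xy = z\<close> (for
  \<open>EqualLeaf z y\<close> take \<open>x = z y\<^sup>-\<^sup>1\<close>), so its color depends only on its kind.\<close>

fun X_color :: "('a, 'm) monoid_scheme \<Rightarrow> 'a xnode \<Rightarrow> node_color" where
  "X_color G (Main C) = (if C = carrier G then Root else Internal)"
| "X_color G (Copy x C) = Internal"
| "X_color G (LeftLeaf x y) = Left"
| "X_color G (RightLeaf x y) = Right"
| "X_color G (EqualLeaf x y) = Equal"

definition X_graph ::
  "('a, 'm) monoid_scheme \<Rightarrow> 'a set list \<Rightarrow> ('a xnode, node_color) colored_graph" where
  "X_graph G S = \<lparr>verts = X_verts G S, edges = X_edges G S, color = X_color G\<rparr>"

end

theory Submission
  imports Defs
begin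

text \<open>An isomorphism \<open>\<phi>\<close> of the series acts on all vertices of \<open>X(S)\<close>, which are built from elements
  and cosets. Conversely, let \<open>f : X(S) \<rightarrow> X(S')\<close> be a colored isomorphism. The vertices colored
  ``root'' or ``internal'' form a tree in which \<open>f\<close> preserves the distance from the root. As all
  leaves of this tree have depth \<open>2m\<close>, the two series have the same length, and \<open>f\<close> preserves the
  parent relation and sends the depth \<open>m\<close> vertex \<open>x\<close> to some \<open>\<phi>(x)\<close>, and
  \<open>y\<^sup>(\<^sup>x\<^sup>)\<close> to a leaf of the copy at \<open>\<phi>(x)\<close>, say the one of \<open>\<psi>\<^sub>x(y)\<close>. The left-right edges give
  \<open>\<psi>\<^sub>x = \<phi>\<close>, and the right-equal edges give \<open>\<phi>(x) \<phi>(y) = \<phi>(x y)\<close>. Since cosets are determined by the leaves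
  below them, \<open>f\<close> is the map induced by \<open>\<phi>\<close>, and \<open>\<phi>(G\<^sub>i)\<close> is the coset of \<open>H\<^sub>i\<close>
  containing \<open>1\<close>.\<close>

subsection \<open>The tree of cosets\<close>

locale composition_series_group = group G for G (structure) +
  fixes S :: "'a set list"
  assumes finite_carrier: "finite (carrier G)"
    and comp_series: "composition_series G S"
begin

definition m :: nat where "m = length S - 1"

abbreviation cosets_at :: "nat \<Rightarrow> 'a set set" where "cosets_at i \<equiv> lcosets (S ! i)"

lemma length_S: "length S = Suc m"
  using comp_series by (simp add: composition_series_def m_def)

lemma S_0: "S ! 0 = {\<one>}"
  using comp_series by (auto simp: composition_series_def hd_conv_nth)

lemma S_m: "S ! m = carrier G"
  using comp_series by (auto simp: composition_series_def last_conv_nth m_def)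

lemma S_normal: "i < m \<Longrightarrow> S ! i \<lhd> G\<lparr>carrier := S ! Suc i\<rparr>"
  using comp_series length_S by (auto simp: composition_series_def)

lemma subgroup_S: "i \<le> m \<Longrightarrow> subgroup (S ! i) G"
proof (induction i rule: inc_induct)
  case base
  show ?case using S_m subgroup_self by simp
next
  case (step i)
  then show ?case
    using S_normal[of i] incl_subgroup normal_imp_subgroup by blast
qed

text \<open>A simple factor is nontrivial, whereas equal neighbouring terms would leave a quotient
  with a single coset.\<close>

lemma S_psubset: assumes "i < m" shows "S ! i \<subset> S ! Suc i"
proof -
  let ?K = "G\<lparr>carrier := S ! Suc i\<rparr>"
  have grp: "group ?K" using subgroup_S[of "Suc i"] assms by (simp add: subgroup_imp_group)
  have sub: "subgroup (S ! i) ?K" using S_normal[OF assms] normal_imp_subgroup by blast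
  have "simple_group (?K Mod (S ! i))"
    using comp_series length_S assms by (auto simp: composition_series_def)
  then have "carrier (?K Mod (S ! i)) \<noteq> {\<one>\<^bsub>?K Mod (S ! i)\<^esub>}"
    by (rule simple_group.simple_not_triv)
  moreover have "S ! i = S ! Suc i \<Longrightarrow> carrier (?K Mod (S ! i)) = {\<one>\<^bsub>?K Mod (S ! i)\<^esub>}"
  proof -
    assume eq: "S ! i = S ! Suc i"
    have "S ! i #>\<^bsub>?K\<^esub> x = S ! i" if "x \<in> carrier ?K" for x
      using group.coset_join2[OF grp _ sub] that eq by simp
    moreover have "\<one> \<in> S ! Suc i" using subgroup_S[of "Suc i"] assms subgroup.one_closed by auto
    ultimately have "rcosets\<^bsub>?K\<^esub> (S ! i) = {S ! i}" by (auto simp: RCOSETS_def)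
    then show ?thesis by (simp add: FactGroup_def)
  qed
  moreover have "S ! i \<subseteq> S ! Suc i" using sub subgroup.subset by fastforce
  ultimately show ?thesis by blast
qed

lemma S_strict_mono: assumes "i < j" "j \<le> m" shows "S ! i \<subset> S ! j"
  using assms
proof (induction j)
  case (Suc j)
  then show ?case using S_psubset[of j] by (cases "i = j") (auto simp: less_Suc_eq)
qed simp

lemma coset_subset: "C \<in> cosets_at i \<Longrightarrow> i \<le> m \<Longrightarrow> C \<subseteq> carrier G"
  using lcosets_subset_PowG subgroup_S by blast

lemma coset_nonempty: "C \<in> cosets_at i \<Longrightarrow> i \<le> m \<Longrightarrow> \<exists>x. x \<in> C"
  using lcos_self subgroup_S by (auto simp: LCOSETS_def)

lemma coset_through: "x \<in> carrier G \<Longrightarrow> i \<le> m \<Longrightarrow> \<exists>C \<in> cosets_at i. x \<in> C"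
  using lcos_self subgroup_S by (auto simp: LCOSETS_def)

lemma coset_eq: "\<lbrakk>C \<in> cosets_at i; D \<in> cosets_at i; i \<le> m; x \<in> C; x \<in> D\<rbrakk> \<Longrightarrow> C = D"
  using lcos_disjoint subgroup_S by blast

lemma cosets_at_0: "cosets_at 0 = (\<lambda>x. {x}) ` carrier G"
  by (auto simp: LCOSETS_def S_0 l_coset_def)

lemma S_coset: "i \<le> m \<Longrightarrow> S ! i \<in> cosets_at i"
  using lcos_mult_one[of "S ! i"] subgroup_S[of i] subgroup.subset
  by (fastforce simp: LCOSETS_def)

lemma cosets_at_m: "cosets_at m = {carrier G}"
proof -
  have "C = carrier G" if "C \<in> cosets_at m" for C
    using coset_eq[OF that S_coset] coset_nonempty[OF that] coset_subset[OF that] S_m by auto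
  then show ?thesis using S_coset[of m] S_m by auto
qed

text \<open>A coset of G_i has as many elements as G_i, and in a finite group these numbers grow
  strictly with i. So a set determines its layer in the tree, which makes \<open>height\<close> well
  defined.\<close>

lemma coset_index_unique:
  assumes "C \<in> cosets_at i" "C \<in> cosets_at j" "i \<le> m" "j \<le> m"
  shows "i = j"
proof -
  have c: "card (S ! k) = card C" "finite (S ! k)" if "C \<in> cosets_at k" "k \<le> m" for k
    using l_card_cosets_equal[OF that(1)] subgroup.subset[OF subgroup_S[OF that(2)]] finite_carrier
    by (auto intro: finite_subset)
  show ?thesis
    using c[OF assms(1,3)] c[OF assms(2,4)] assms S_strict_mono psubset_card_mono
    by (metis less_irrefl linorder_neqE_nat)
qed

text \<open>Translating the inclusion of G_i in G_(i+1) by x gives nested cosets through x, and the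
  larger one is C because cosets through a common point agree.\<close>

lemma coset_split:
  assumes "C \<in> cosets_at (Suc i)" "i < m" "x \<in> C"
  shows "\<exists>D \<in> cosets_at i. x \<in> D \<and> D \<subseteq> C"
proof -
  have x: "x \<in> carrier G" using assms coset_subset[of C "Suc i"] by auto
  have "x <# (S ! Suc i) \<in> cosets_at (Suc i)" "x <# (S ! i) \<in> cosets_at i"
    using x by (auto simp: LCOSETS_def)
  moreover have "x \<in> x <# (S ! Suc i)" "x \<in> x <# (S ! i)"
    using x assms subgroup_S lcos_self by auto
  moreover have "x <# (S ! i) \<subseteq> x <# (S ! Suc i)"
    using S_psubset[OF assms(2)] by (auto simp: l_coset_def)
  ultimately show ?thesis
    using coset_eq[of C "Suc i" "x <# (S ! Suc i)" x] assms by auto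
qed

lemma coset_parent:
  assumes "D \<in> cosets_at i" "i < m"
  shows "\<exists>C \<in> cosets_at (Suc i). D \<subseteq> C"
proof -
  obtain x where x: "x \<in> D" using coset_nonempty assms by (meson less_imp_le)
  then have "x \<in> carrier G" using coset_subset[OF assms(1)] assms by auto
  then obtain C where C: "C \<in> cosets_at (Suc i)" "x \<in> C" using coset_through assms by (meson Suc_leI)
  obtain E where "E \<in> cosets_at i" "x \<in> E" "E \<subseteq> C" using coset_split[OF C(1) assms(2) C(2)] by blast
  then show ?thesis using coset_eq[of D i E x] assms x C by auto
qed

lemma tree_nodes_iff: "C \<in> tree_nodes G S \<longleftrightarrow> (\<exists>i\<le>m. C \<in> cosets_at i)"
  using length_S by (auto simp: tree_nodes_def less_Suc_eq_le)

lemma tree_edges_iff: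
  "(C, D) \<in> tree_edges G S \<longleftrightarrow> (\<exists>i<m. C \<in> cosets_at (Suc i) \<and> D \<in> cosets_at i \<and> D \<subseteq> C)"
  using length_S by (auto simp: tree_edges_def)

text \<open>Counted from the leaves (0) up to the root (\<open>m\<close>); unique by
  \<open>coset_index_unique\<close>.\<close>

definition height :: "'a set \<Rightarrow> nat" where
  "height C = (THE i. i \<le> m \<and> C \<in> cosets_at i)"

lemma height_eq: "C \<in> cosets_at i \<Longrightarrow> i \<le> m \<Longrightarrow> height C = i"
  unfolding height_def using coset_index_unique by (intro the_equality) auto

lemma cosets_at_height: "C \<in> tree_nodes G S \<Longrightarrow> C \<in> cosets_at (height C) \<and> height C \<le> m"
  using tree_nodes_iff height_eq by fastforce

lemma height_carrier: "height (carrier G) = m"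
  using height_eq[of "carrier G" m] cosets_at_m by simp

lemma height_singleton: "x \<in> carrier G \<Longrightarrow> height {x} = 0"
  using height_eq[of "{x}" 0] cosets_at_0 by simp

lemma height_0D: "C \<in> tree_nodes G S \<Longrightarrow> height C = 0 \<Longrightarrow> \<exists>x\<in>carrier G. C = {x}"
  using cosets_at_height[of C] cosets_at_0 by auto

lemma height_mD: "C \<in> tree_nodes G S \<Longrightarrow> height C = m \<Longrightarrow> C = carrier G"
  using cosets_at_height[of C] cosets_at_m by auto

lemma carrier_in_tree: "carrier G \<in> tree_nodes G S"
  using cosets_at_m tree_nodes_iff by auto

lemma singleton_in_tree: "x \<in> carrier G \<Longrightarrow> {x} \<in> tree_nodes G S"
  using cosets_at_0 tree_nodes_iff by auto

lemma tree_edgeD: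
  assumes "(C, D) \<in> tree_edges G S"
  shows "C \<in> tree_nodes G S" "D \<in> tree_nodes G S" "height C = Suc (height D)" "height C \<le> m" "D \<subseteq> C"
  using assms height_eq unfolding tree_edges_iff tree_nodes_iff
  by (metis Suc_leI less_imp_le)+

lemma tree_edge_parent:
  assumes "D \<in> tree_nodes G S" "height D < m"
  shows "\<exists>C. (C, D) \<in> tree_edges G S"
  using assms cosets_at_height[of D] coset_parent[of D "height D"] by (auto simp: tree_edges_iff)

lemma tree_edge_child:
  assumes "C \<in> tree_nodes G S" "0 < height C" "x \<in> C"
  shows "\<exists>D. (C, D) \<in> tree_edges G S \<and> x \<in> D"
proof -
  obtain i where "height C = Suc i" using assms by (cases "height C") auto
  then show ?thesis
    using assms cosets_at_height[of C] coset_split[of C i x]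
    by (auto simp: tree_edges_iff Suc_le_eq)
qed

text \<open>Nodes of equal height are cosets of the same subgroup, hence disjoint or equal: height
  and one element identify a node.\<close>

lemma tree_node_eq:
  "\<lbrakk>C \<in> tree_nodes G S; D \<in> tree_nodes G S; height C = height D; x \<in> C; x \<in> D\<rbrakk> \<Longrightarrow> C = D"
  using coset_eq cosets_at_height by metis

lemma tree_node_subset: "C \<in> tree_nodes G S \<Longrightarrow> C \<subseteq> carrier G"
  using coset_subset tree_nodes_iff by auto

end

subsection \<open>The tree inside the graph\<close>

lemma X_edges_intros:
  "(C, D) \<in> tree_edges G S \<Longrightarrow> {Main C, Main D} \<in> X_edges G S"
  "\<lbrakk>x \<in> carrier G; (C, D) \<in> tree_edges G S\<rbrakk> \<Longrightarrow> {copy_node G x C, copy_node G x D} \<in> X_edges G S"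
  "\<lbrakk>x \<in> carrier G; y \<in> carrier G\<rbrakk> \<Longrightarrow> {copy_node G x {y}, LeftLeaf x y} \<in> X_edges G S"
  "\<lbrakk>x \<in> carrier G; y \<in> carrier G\<rbrakk> \<Longrightarrow> {copy_node G x {y}, RightLeaf x y} \<in> X_edges G S"
  "\<lbrakk>x \<in> carrier G; y \<in> carrier G\<rbrakk> \<Longrightarrow> {copy_node G x {y}, EqualLeaf x y} \<in> X_edges G S"
  "\<lbrakk>x \<in> carrier G; y \<in> carrier G\<rbrakk> \<Longrightarrow> {LeftLeaf x y, RightLeaf y x} \<in> X_edges G S"
  "\<lbrakk>x \<in> carrier G; y \<in> carrier G\<rbrakk> \<Longrightarrow> {RightLeaf y x, EqualLeaf (x \<otimes>\<^bsub>G\<^esub> y) y} \<in> X_edges G S"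
  unfolding X_edges_def
        apply (rule UnI1, rule UnI1, rule UnI1, intro CollectI exI conjI, rule refl, assumption)
       apply (rule UnI1, rule UnI1, rule UnI2, intro CollectI exI conjI, rule refl, assumption+)
      apply (rule UnI1, rule UnI2, rule UN_I[of x], assumption, rule UN_I[of y], assumption, simp)
     apply (rule UnI1, rule UnI2, rule UN_I[of x], assumption, rule UN_I[of y], assumption, simp)
    apply (rule UnI1, rule UnI2, rule UN_I[of x], assumption, rule UN_I[of y], assumption, simp)
   apply (rule UnI2, rule UN_I[of x], assumption, rule UN_I[of y], assumption, simp)+
  done

lemma X_edges_cases:
  assumes "e \<in> X_edges G S"
  obtains (Main) C D where "(C, D) \<in> tree_edges G S" "e = {Main C, Main D}"
    | (copy) x C D where "x \<in> carrier G" "(C, D) \<in> tree_edges G S"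
        "e = {copy_node G x C, copy_node G x D}"
    | (leaf) x y l where "x \<in> carrier G" "y \<in> carrier G"
        "l \<in> {LeftLeaf x y, RightLeaf x y, EqualLeaf x y}" "e = {copy_node G x {y}, l}"
    | (left) x y where "x \<in> carrier G" "y \<in> carrier G" "e = {LeftLeaf x y, RightLeaf y x}"
    | (right) x y where "x \<in> carrier G" "y \<in> carrier G"
        "e = {RightLeaf y x, EqualLeaf (x \<otimes>\<^bsub>G\<^esub> y) y}"
proof -
  consider "e \<in> {{Main C, Main D} | C D. (C, D) \<in> tree_edges G S}"
    | "e \<in> {{copy_node G x C, copy_node G x D} | x C D. x \<in> carrier G \<and> (C, D) \<in> tree_edges G S}"
    | "e \<in> (\<Union>x\<in>carrier G. \<Union>y\<in>carrier G. {{copy_node G x {y}, LeftLeaf x y},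
         {copy_node G x {y}, RightLeaf x y}, {copy_node G x {y}, EqualLeaf x y}})"
    | "e \<in> (\<Union>x\<in>carrier G. \<Union>y\<in>carrier G. {{LeftLeaf x y, RightLeaf y x},
         {RightLeaf y x, EqualLeaf (x \<otimes>\<^bsub>G\<^esub> y) y}})"
    using assms unfolding X_edges_def by (elim UnE)
  then show thesis
  proof cases
    case 1
    then show ?thesis using Main by (elim CollectE exE conjE)
  next
    case 2
    then show ?thesis using copy by (elim CollectE exE conjE)
  next
    case 3
    \<comment> \<open>Rotating the premises puts the equation for \<open>e\<close> first, so that it
      fixes the elements and the leaf before the membership goals are met.\<close>
    then show ?thesis by (elim UN_E insertE emptyE) (rule leaf[rotated 3], assumption, assumption, assumption, simp)+
  next
    case 4
    then show ?thesis
      by (elim UN_E insertE emptyE) ((rule left, assumption, assumption, assumption) |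
        (rule right, assumption, assumption, assumption))+
  qed
qed


section \<open>The uncolored tree part of X(S): levels and parents\<close>

context composition_series_group
begin

text \<open>What remains of X(S) without the three kinds of pendant leaves: the tree
  \<open>T_S\<close> with the copies glued on. Being cut out by colors, it is respected by every
  colored isomorphism.\<close>

definition skeleton :: "'a xnode set" where
  "skeleton = {v \<in> X_verts G S. X_color G v \<in> {Root, Internal}}"

text \<open>Distance from the root within \<open>skeleton\<close>. A copy hangs below level
  \<open>m\<close>, so its node C lies at m + (m - height C); at the gluing vertices both formulas
  give \<open>m\<close>. The value 0 on pendant leaves is a dummy.\<close>

definition level :: "'a xnode \<Rightarrow> nat" where
  "level v = (case v of Main C \<Rightarrow> m - height C | Copy x C \<Rightarrow> 2 * m - height C | _ \<Rightarrow> 0)"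

text \<open>Edges of X(S) are unordered; this restores the orientation away from the root. Using
  \<open>copy_node\<close> lets a glued leaf of \<open>T_S\<close> also serve as the root of its
  copy.\<close>

definition parent :: "'a xnode \<Rightarrow> 'a xnode \<Rightarrow> bool" where
  "parent u v \<longleftrightarrow> (\<exists>C D. (C, D) \<in> tree_edges G S \<and>
     (u = Main C \<and> v = Main D \<or> (\<exists>x\<in>carrier G. u = copy_node G x C \<and> v = copy_node G x D)))"

lemma skeleton_iff:
  "v \<in> skeleton \<longleftrightarrow> (\<exists>C\<in>tree_nodes G S. v = Main C) \<or>
     (\<exists>x\<in>carrier G. \<exists>C\<in>tree_nodes G S. v = copy_node G x C)"
  unfolding skeleton_def X_verts_def copy_node_def by (auto split: if_splits)

lemma Main_in_skeleton_iff: "Main C \<in> skeleton \<longleftrightarrow> C \<in> tree_nodes G S"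
  using singleton_in_tree by (auto simp: skeleton_iff copy_node_def split: if_splits)

lemma copy_node_in_skeleton:
  "x \<in> carrier G \<Longrightarrow> C \<in> tree_nodes G S \<Longrightarrow> copy_node G x C \<in> skeleton"
  by (auto simp: skeleton_iff)

lemma level_Main: "level (Main C) = m - height C"
  by (simp add: level_def)

lemma level_copy_node: "x \<in> carrier G \<Longrightarrow> level (copy_node G x C) = 2 * m - height C"
  by (simp add: level_def copy_node_def height_singleton height_carrier)

lemma level_le: "v \<in> skeleton \<Longrightarrow> level v \<le> 2 * m"
  by (auto simp: skeleton_iff level_Main level_copy_node)

lemma parentD:
  assumes "parent u v"
  shows "u \<in> skeleton" "v \<in> skeleton" "level v = Suc (level u)"
proof -
  obtain C D where CD: "(C, D) \<in> tree_edges G S"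
    and uv: "u = Main C \<and> v = Main D \<or> (\<exists>x\<in>carrier G. u = copy_node G x C \<and> v = copy_node G x D)"
    using assms by (auto simp: parent_def)
  note D = tree_edgeD[OF CD]
  show "u \<in> skeleton" "v \<in> skeleton" using uv D(1,2) by (auto simp: skeleton_iff)
  show "level v = Suc (level u)" using uv D(3,4) by (auto simp: level_Main level_copy_node)
qed

lemma parent_Main: "(C, D) \<in> tree_edges G S \<Longrightarrow> parent (Main C) (Main D)"
  by (auto simp: parent_def)

lemma parent_copy_node:
  "(C, D) \<in> tree_edges G S \<Longrightarrow> x \<in> carrier G \<Longrightarrow> parent (copy_node G x C) (copy_node G x D)"
  by (auto simp: parent_def)

text \<open>Every edge that does not come from a tree has a pendant leaf as an endpoint, so the
  graph induced on \<open>skeleton\<close> is exactly the tree described by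
  \<open>parent\<close>.\<close>

lemma X_edge_skeleton_iff:
  assumes "u \<in> skeleton" "v \<in> skeleton"
  shows "{u, v} \<in> X_edges G S \<longleftrightarrow> parent u v \<or> parent v u"
proof -
  have n: "u \<noteq> LeftLeaf x y" "u \<noteq> RightLeaf x y" "u \<noteq> EqualLeaf x y"
    "v \<noteq> LeftLeaf x y" "v \<noteq> RightLeaf x y" "v \<noteq> EqualLeaf x y" for x y
    using assms by (auto simp: skeleton_def)
  show ?thesis
  proof
    assume "{u, v} \<in> X_edges G S"
    then show "parent u v \<or> parent v u"
    proof (cases rule: X_edges_cases)
      case (Main C D)
      then show ?thesis using parent_Main by (auto simp: doubleton_eq_iff)
    next
      case (copy x C D)
      then show ?thesis using parent_copy_node by (auto simp: doubleton_eq_iff)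
    qed (auto simp: doubleton_eq_iff n)
  next
    have *: "{a, b} \<in> X_edges G S" if "parent a b" for a b
      using that unfolding parent_def by (auto intro: X_edges_intros)
    assume "parent u v \<or> parent v u"
    then show "{u, v} \<in> X_edges G S" using *[of u v] *[of v u] by (auto simp: insert_commute)
  qed
qed

lemma parent_exists:
  assumes "v \<in> skeleton" "0 < level v"
  shows "\<exists>u. parent u v"
proof -
  have Main: "\<exists>u. parent u (Main C)" if "C \<in> tree_nodes G S" "0 < level (Main C)" for C
    using tree_edge_parent[OF that(1)] that(2) parent_Main by (auto simp: level_Main)
  consider C where "C \<in> tree_nodes G S" "v = Main C"
    | x C where "x \<in> carrier G" "C \<in> tree_nodes G S" "v = copy_node G x C"
    using assms(1) by (auto simp: skeleton_iff)
  then show ?thesis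
  proof cases
    case 1
    then show ?thesis using Main assms(2) by auto
  next
    case (2 x C)
    show ?thesis
    proof (cases "height C < m")
      case True
      then show ?thesis using tree_edge_parent[OF 2(2)] 2 parent_copy_node by blast
    next
      case False
      \<comment> \<open>The root of the copy is the leaf \<open>Main {x}\<close> of
        \<open>T_S\<close>, so its parent has to be sought in the main tree.\<close>
      then have "C = carrier G" using height_mD[OF 2(2)] cosets_at_height[OF 2(2)] by auto
      then have "v = Main {x}" using 2 by (simp add: copy_node_def)
      then show ?thesis using Main singleton_in_tree[OF 2(1)] assms(2) by auto
    qed
  qed
qed

lemma X_color_Root_iff: "X_color G v = Root \<longleftrightarrow> v = Main (carrier G)"
  by (cases v) auto

lemma level_0_iff:
  assumes "v \<in> skeleton"
  shows "level v = 0 \<longleftrightarrow> v = Main (carrier G)"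
proof
  assume L: "level v = 0"
  consider C where "C \<in> tree_nodes G S" "v = Main C"
    | x C where "x \<in> carrier G" "C \<in> tree_nodes G S" "v = copy_node G x C"
    using assms(1) by (auto simp: skeleton_iff)
  then show "v = Main (carrier G)"
  proof cases
    case 1
    then show ?thesis using L cosets_at_height[OF 1(1)] height_mD[OF 1(1)] by (auto simp: level_Main)
  next
    case (2 x C)
    \<comment> \<open>Copy vertices have level at least \<open>m\<close>, so level 0 leaves only the
      trivial group, where the whole skeleton collapses to one vertex.\<close>
    then have "m = 0" using L cosets_at_height[OF 2(2)] by (auto simp: level_copy_node)
    then have "D = carrier G" if "D \<in> tree_nodes G S" for D
      using height_mD[OF that] cosets_at_height[OF that] by auto
    then show ?thesis using 2 singleton_in_tree[OF 2(1)] by (auto simp: copy_node_def)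
  qed
qed (simp add: level_Main height_carrier)

lemma level_m:
  assumes "v \<in> skeleton" "level v = m"
  shows "\<exists>x\<in>carrier G. v = Main {x}"
proof -
  consider C where "C \<in> tree_nodes G S" "v = Main C"
    | x C where "x \<in> carrier G" "C \<in> tree_nodes G S" "v = copy_node G x C"
    using assms(1) by (auto simp: skeleton_iff)
  then show ?thesis
  proof cases
    case 1
    then have "height C = 0" using assms(2) cosets_at_height[OF 1(1)] by (auto simp: level_Main)
    then show ?thesis using height_0D[OF 1(1)] 1 by auto
  next
    case (2 x C)
    then have "height C = m" using assms(2) cosets_at_height[OF 2(2)] by (auto simp: level_copy_node)
    then show ?thesis using height_mD[OF 2(2)] 2 by (auto simp: copy_node_def)
  qed
qed

text \<open>A vertex of \<open>T_S\<close> that is also the root of a copy lies at level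
  \<open>m\<close>. Strictly above that level, children can only come from
  \<open>T_S\<close>.\<close>

lemma parent_Main_cases:
  assumes "parent (Main C) v" "level (Main C) < m"
  shows "\<exists>D. v = Main D \<and> (C, D) \<in> tree_edges G S"
proof -
  have "False" if "Main C = copy_node G x E" "x \<in> carrier G" for x E
    using that assms(2) by (auto simp: copy_node_def level_Main height_singleton split: if_splits)
  then show ?thesis using assms(1) by (auto simp: parent_def)
qed

lemma copy_node_inject:
  "copy_node G x C = copy_node G y D \<longleftrightarrow> x = y \<and> C = D"
  by (auto simp: copy_node_def)

text \<open>The only vertex a copy shares with \<open>T_S\<close> is its root. There it is a leaf of
  \<open>T_S\<close>, which has no children in the main tree, so descending never leaves the
  copy.\<close>

lemma parent_copy_node_cases:
  assumes "parent (copy_node G x C) v" "x \<in> carrier G"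
  shows "\<exists>D. v = copy_node G x D \<and> (C, D) \<in> tree_edges G S"
proof -
  have "False" if "copy_node G x C = Main E" "(E, D) \<in> tree_edges G S" for E D
    using that assms(2) tree_edgeD(3)[OF that(2)]
    by (auto simp: copy_node_def height_singleton split: if_splits)
  then show ?thesis using assms(1) by (auto simp: parent_def copy_node_inject)
qed

text \<open>A pendant leaf has a single neighbour in the skeleton. Hence the image of a pendant leaf
  is determined by its color and the image of that neighbour.\<close>

lemma skeleton_leaf_edge_iff:
  assumes "w \<in> skeleton" "x \<in> carrier G" "y \<in> carrier G"
  shows "{w, LeftLeaf x y} \<in> X_edges G S \<longleftrightarrow> w = copy_node G x {y}"
    "{w, RightLeaf x y} \<in> X_edges G S \<longleftrightarrow> w = copy_node G x {y}"
    "{w, EqualLeaf x y} \<in> X_edges G S \<longleftrightarrow> w = copy_node G x {y}"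
proof -
  have n: "w \<noteq> LeftLeaf a b" "w \<noteq> RightLeaf a b" "w \<noteq> EqualLeaf a b" for a b
    using assms by (auto simp: skeleton_def)
  have *: "w = copy_node G x {y}"
    if "{w, l} \<in> X_edges G S" and l: "l \<in> {LeftLeaf x y, RightLeaf x y, EqualLeaf x y}" for l
    using that(1)
  proof (cases rule: X_edges_cases)
    case (leaf a b k)
    \<comment> \<open>A tree vertex differs from a pendant leaf, so the two doubletons can be
      matched in only one way.\<close>
    have "w \<noteq> k" using leaf(3) by (auto simp: n)
    then have "w = copy_node G a {b}" "l = k" using leaf(4) by (simp_all add: doubleton_eq_iff)
    then show ?thesis using leaf(3) l by auto
  next
    case (Main C D)
    then show ?thesis using l by (auto simp: doubleton_eq_iff)
  next
    case (copy z C D)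
    then have "l \<in> {copy_node G z C, copy_node G z D}" by (auto simp: doubleton_eq_iff)
    then show ?thesis using l by (auto simp: copy_node_def split: if_splits)
  qed (simp_all add: doubleton_eq_iff n)
  show "{w, LeftLeaf x y} \<in> X_edges G S \<longleftrightarrow> w = copy_node G x {y}"
    by (rule iffI, erule *) (use assms in \<open>simp_all add: X_edges_intros\<close>)
  show "{w, RightLeaf x y} \<in> X_edges G S \<longleftrightarrow> w = copy_node G x {y}"
    by (rule iffI, erule *) (use assms in \<open>simp_all add: X_edges_intros\<close>)
  show "{w, EqualLeaf x y} \<in> X_edges G S \<longleftrightarrow> w = copy_node G x {y}"
    by (rule iffI, erule *) (use assms in \<open>simp_all add: X_edges_intros\<close>)
qed

text \<open>These edges carry the multiplication table: from a left leaf the right leaf is forced,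
  and from the right leaf the equal leaf, whose superscript is the product.\<close>

lemma leaf_leaf_edge_iff:
  assumes "x \<in> carrier G" "y \<in> carrier G"
  shows "{LeftLeaf x y, RightLeaf a b} \<in> X_edges G S \<longleftrightarrow> a = y \<and> b = x"
    "{RightLeaf y x, EqualLeaf a b} \<in> X_edges G S \<longleftrightarrow> a = x \<otimes> y \<and> b = y"
proof -
  have "a = y \<and> b = x" if "{LeftLeaf x y, RightLeaf a b} \<in> X_edges G S"
    using that
    by (cases rule: X_edges_cases) (auto simp: doubleton_eq_iff copy_node_def split: if_splits)
  moreover have "a = x \<otimes> y \<and> b = y" if "{RightLeaf y x, EqualLeaf a b} \<in> X_edges G S"
    using that
    by (cases rule: X_edges_cases) (auto simp: doubleton_eq_iff copy_node_def split: if_splits)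
  ultimately show "{LeftLeaf x y, RightLeaf a b} \<in> X_edges G S \<longleftrightarrow> a = y \<and> b = x"
    "{RightLeaf y x, EqualLeaf a b} \<in> X_edges G S \<longleftrightarrow> a = x \<otimes> y \<and> b = y"
    using X_edges_intros(6,7)[OF assms] by auto
qed

end

subsection \<open>From series isomorphisms to graph isomorphisms\<close>

text \<open>With an explicit inverse, the edge equivalence splits into two implications, so one
  preservation lemma can serve both directions.\<close>

lemma graph_IsoI:
  assumes f: "f \<in> extensional (verts X)"
    and g: "\<And>v. v \<in> verts X \<Longrightarrow> g (f v) = v" "\<And>w. w \<in> verts Y \<Longrightarrow> f (g w) = w"
    and verts: "\<And>v. v \<in> verts X \<Longrightarrow> f v \<in> verts Y" "\<And>w. w \<in> verts Y \<Longrightarrow> g w \<in> verts X"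
    and edges: "\<And>u v. \<lbrakk>u \<in> verts X; v \<in> verts X; {u, v} \<in> edges X\<rbrakk> \<Longrightarrow> {f u, f v} \<in> edges Y"
      "\<And>u v. \<lbrakk>u \<in> verts Y; v \<in> verts Y; {u, v} \<in> edges Y\<rbrakk> \<Longrightarrow> {g u, g v} \<in> edges X"
    and color: "\<And>v. v \<in> verts X \<Longrightarrow> color Y (f v) = color X v"
  shows "f \<in> graph_Iso X Y"
proof -
  have "bij_betw f (verts X) (verts Y)"
    by (rule bij_betw_byWitness[where f' = g]) (use g verts in auto)
  moreover have "{u, v} \<in> edges X \<longleftrightarrow> {f u, f v} \<in> edges Y" if "u \<in> verts X" "v \<in> verts X" for u v
    using edges(1)[OF that] edges(2)[OF verts(1)[OF that(1)] verts(1)[OF that(2)]] g(1) that by auto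
  ultimately show ?thesis using f color by (auto simp: graph_Iso_def)
qed

text \<open>Restriction supplies the extensionality that \<open>graph_Iso\<close> demands. The
  inverse later turns a one-sided estimate on levels into an equality.\<close>

lemma graph_Iso_inverse:
  assumes "f \<in> graph_Iso X Y"
  shows "restrict (inv_into (verts X) f) (verts Y) \<in> graph_Iso Y X"
proof -
  let ?g = "restrict (inv_into (verts X) f) (verts Y)"
  have bij: "bij_betw f (verts X) (verts Y)"
    and edges: "\<And>u v. u \<in> verts X \<Longrightarrow> v \<in> verts X \<Longrightarrow> {u, v} \<in> edges X \<longleftrightarrow> {f u, f v} \<in> edges Y"
    and color: "\<And>u. u \<in> verts X \<Longrightarrow> color Y (f u) = color X u"
    using assms by (auto simp: graph_Iso_def)
  have g: "?g w \<in> verts X" "f (?g w) = w" if "w \<in> verts Y" for w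
    using that bij by (auto simp: bij_betw_inv_into_right bij_betwE bij_betw_def inv_into_into f_inv_into_f)
  have "?g (f v) = v" if "v \<in> verts X" for v
    using that bij by (simp add: bij_betw_inv_into_left bij_betwE)
  then show ?thesis
    using g edges color bij_betwE[OF bij]
    by (intro graph_IsoI[where g = f]) (auto, metis)
qed

fun xnode_map :: "('a \<Rightarrow> 'b) \<Rightarrow> 'a xnode \<Rightarrow> 'b xnode" where
  "xnode_map \<phi> (Main C) = Main (\<phi> ` C)"
| "xnode_map \<phi> (Copy x C) = Copy (\<phi> x) (\<phi> ` C)"
| "xnode_map \<phi> (LeftLeaf x y) = LeftLeaf (\<phi> x) (\<phi> y)"
| "xnode_map \<phi> (RightLeaf x y) = RightLeaf (\<phi> x) (\<phi> y)"
| "xnode_map \<phi> (EqualLeaf x y) = EqualLeaf (\<phi> x) (\<phi> y)"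

locale composition_series_pair =
  G: composition_series_group G S + H: composition_series_group H S'
  for G :: "('a, 'm) monoid_scheme" and S and H :: "('b, 'n) monoid_scheme" and S'
begin

text \<open>Facts proved for a map from G to H thereby become available for its inverse.\<close>

lemma swap: "composition_series_pair H S' G S"
  by unfold_locales

lemma series_Iso_inverse:
  assumes "\<phi> \<in> series_Iso G S H S'"
  shows "restrict (inv_into (carrier G) \<phi>) (carrier H) \<in> series_Iso H S' G S"
proof -
  let ?g = "inv_into (carrier G) \<phi>"
  have iso: "\<phi> \<in> iso G H" and len: "length S = length S'"
    and S: "\<And>i. i < length S \<Longrightarrow> \<phi> ` (S ! i) = S' ! i"
    using assms by (auto simp: series_Iso_def)
  have inj: "inj_on \<phi> (carrier G)" using iso by (auto simp: iso_def bij_betw_def)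
  have "?g \<in> iso H G" by (rule G.iso_set_sym[OF iso])
  then have "restrict ?g (carrier H) \<in> iso H G" 
    using H.m_closed by (auto simp: iso_def hom_def bij_betw_restrict_eq Pi_iff)
  moreover have "restrict ?g (carrier H) ` (S' ! i) = S ! i" if "i < length S'" for i
  proof -
    have sub: "S ! i \<subseteq> carrier G" "S' ! i \<subseteq> carrier H"
      using G.subgroup_S[of i] H.subgroup_S[of i] that len G.length_S H.length_S subgroup.subset
      by (fastforce simp: less_Suc_eq_le)+
    have "restrict ?g (carrier H) ` (S' ! i) = ?g ` (\<phi> ` (S ! i))"
      using S that len sub(2) by (intro image_cong) auto
    also have "\<dots> = S ! i" using inj sub(1) by (simp add: inv_into_image_cancel)
    finally show ?thesis .
  qed
  ultimately show ?thesis using len by (auto simp: series_Iso_def)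
qed

section \<open>The action of a series isomorphism on vertices, colors and edges\<close>

context
  fixes \<phi>
  assumes phi: "\<phi> \<in> series_Iso G S H S'"
begin

lemma phi_bij: "bij_betw \<phi> (carrier G) (carrier H)"
  and phi_hom: "\<phi> \<in> hom G H"
  and length_eq: "length S = length S'"
  and phi_S: "i < length S \<Longrightarrow> \<phi> ` (S ! i) = S' ! i"
  using phi by (auto simp: series_Iso_def iso_def)

lemma phi_closed: "x \<in> carrier G \<Longrightarrow> \<phi> x \<in> carrier H"
  using phi_bij by (rule bij_betwE[THEN bspec])

lemma phi_image_eq: "C \<subseteq> carrier G \<Longrightarrow> D \<subseteq> carrier G \<Longrightarrow> \<phi> ` C = \<phi> ` D \<longleftrightarrow> C = D"
  using phi_bij by (auto simp: bij_betw_def inj_on_image_eq_iff)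

lemma phi_image_carrier: "\<phi> ` carrier G = carrier H"
  using phi_bij by (simp add: bij_betw_def)

text \<open>A homomorphism sends the coset of x to the coset of \<open>\<phi> x\<close> modulo the
  image subgroup, here H_i.\<close>

lemma phi_coset:
  assumes "C \<in> lcosets\<^bsub>G\<^esub> (S ! i)" "i \<le> G.m"
  shows "\<phi> ` C \<in> lcosets\<^bsub>H\<^esub> (S' ! i)"
proof -
  obtain x where x: "x \<in> carrier G" "C = x <#\<^bsub>G\<^esub> (S ! i)" using assms by (auto simp: LCOSETS_def)
  have "S ! i \<subseteq> carrier G" using G.subgroup_S assms subgroup.subset by blast
  then have "\<phi> ` C = \<phi> x <#\<^bsub>H\<^esub> (\<phi> ` (S ! i))"
    using x hom_mult[OF phi_hom x(1)] by (simp add: l_coset_def image_UN subset_iff)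
  then show ?thesis
    using x phi_closed phi_S[of i] assms(2) G.length_S by (auto simp: LCOSETS_def)
qed

lemma m_eq_of_series_Iso: "G.m = H.m"
  using length_eq G.length_S H.length_S by simp

lemma phi_tree_node: "C \<in> tree_nodes G S \<Longrightarrow> \<phi> ` C \<in> tree_nodes H S'"
  using phi_coset m_eq_of_series_Iso by (auto simp: G.tree_nodes_iff H.tree_nodes_iff)

lemma phi_tree_edge:
  assumes "(C, D) \<in> tree_edges G S"
  shows "(\<phi> ` C, \<phi> ` D) \<in> tree_edges H S'"
proof -
  obtain i where i: "i < G.m" "C \<in> G.cosets_at (Suc i)" "D \<in> G.cosets_at i" "D \<subseteq> C"
    using assms unfolding G.tree_edges_iff by blast
  then have "\<phi> ` C \<in> H.cosets_at (Suc i)" "\<phi> ` D \<in> H.cosets_at i" "\<phi> ` D \<subseteq> \<phi> ` C"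
    by (auto intro: phi_coset)
  then show ?thesis using i(1) m_eq_of_series_Iso unfolding H.tree_edges_iff by auto
qed

text \<open>Compatibility with the gluing: by injectivity only the full carrier is mapped onto
  \<open>carrier H\<close>, so copy roots go to copy roots and no other node does.\<close>

lemma xnode_map_copy_node:
  assumes "C \<in> tree_nodes G S"
  shows "xnode_map \<phi> (copy_node G x C) = copy_node H (\<phi> x) (\<phi> ` C)"
  using phi_image_eq[OF G.tree_node_subset[OF assms] order_refl] phi_image_carrier
  by (auto simp: copy_node_def)

lemma xnode_map_vert:
  assumes "v \<in> X_verts G S"
  shows "xnode_map \<phi> v \<in> X_verts H S'"
  using assms unfolding X_verts_def
  by (elim UnE UN_E CollectE exE conjE imageE insertE emptyE)
    (simp_all add: xnode_map_copy_node phi_tree_node phi_closed,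
     use phi_closed phi_tree_node in blast)

lemma xnode_map_color:
  assumes "v \<in> X_verts G S"
  shows "X_color H (xnode_map \<phi> v) = X_color G v"
proof (cases v)
  case (Main C)
  then have "v \<in> G.skeleton" using assms by (auto simp: G.skeleton_def)
  then have "C \<subseteq> carrier G" using Main G.Main_in_skeleton_iff G.tree_node_subset by auto
  then show ?thesis using Main phi_image_eq[OF _ order_refl, of C] phi_image_carrier by auto
qed auto

text \<open>Each kind of edge goes to an edge of the same kind. The right-equal edges are where
  multiplicativity of \<open>\<phi>\<close> enters.\<close>

lemma xnode_map_edge:
  assumes "e \<in> X_edges G S"
  shows "xnode_map \<phi> ` e \<in> X_edges H S'"
proof -
  from assms show ?thesis
  proof (cases rule: X_edges_cases)
    case Main
    then show ?thesis using phi_tree_edge by (simp add: X_edges_intros)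
  next
    case (copy x C D)
    then show ?thesis
      using G.tree_edgeD(1,2)[OF copy(2)] phi_tree_edge phi_closed
      by (simp add: xnode_map_copy_node X_edges_intros)
  next
    case leaf
    then show ?thesis
      using phi_closed G.singleton_in_tree by (auto simp: xnode_map_copy_node X_edges_intros)
  next
    case left
    then show ?thesis using phi_closed by (simp add: X_edges_intros)
  next
    case right
    then show ?thesis
      using phi_closed hom_mult[OF phi_hom] by (auto simp: X_edges_intros)
  qed
qed

end

lemma xnode_map_inverse:
  assumes g: "\<And>x. x \<in> carrier G \<Longrightarrow> g (\<phi> x) = x" and v: "v \<in> X_verts G S"
  shows "xnode_map g (xnode_map \<phi> v) = v"
proof -
  have image: "g ` \<phi> ` C = C" if "C \<in> tree_nodes G S" for C
  proof -
    have "g ` \<phi> ` C = (\<lambda>x. x) ` C"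
      unfolding image_image using G.tree_node_subset[OF that] g by (intro image_cong) auto
    then show ?thesis by simp
  qed
  have "xnode_map g (xnode_map \<phi> (copy_node G x C)) = copy_node G x C"
    if "x \<in> carrier G" "C \<in> tree_nodes G S" for x C
    using that g image by (simp add: copy_node_def)
  then show ?thesis
    using v image g unfolding X_verts_def
    by (elim UnE UN_E CollectE exE conjE imageE insertE emptyE) simp_all
qed

lemma xnode_map_graph_Iso:
  assumes "\<phi> \<in> series_Iso G S H S'"
  shows "restrict (xnode_map \<phi>) (X_verts G S) \<in> graph_Iso (X_graph G S) (X_graph H S')"
proof -
  interpret swap: composition_series_pair H S' G S by (rule swap)
  define g where "g = restrict (inv_into (carrier G) \<phi>) (carrier H)"
  have g: "g \<in> series_Iso H S' G S" unfolding g_def by (rule series_Iso_inverse[OF assms])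
  have "g (\<phi> x) = x" if "x \<in> carrier G" for x
    using that phi_bij[OF assms] phi_closed[OF assms] by (simp add: g_def bij_betw_inv_into_left)
  note inv1 = xnode_map_inverse[of g \<phi>, OF this]
  have "\<phi> (g y) = y" if "y \<in> carrier H" for y
    using that phi_bij[OF assms] by (simp add: g_def bij_betw_inv_into_right)
  note inv2 = swap.xnode_map_inverse[of \<phi> g, OF this]
  note vert = xnode_map_vert[OF assms] swap.xnode_map_vert[OF g]
  show ?thesis
  proof (rule graph_IsoI[where g = "xnode_map g"])
    fix u v
    show "{restrict (xnode_map \<phi>) (X_verts G S) u, restrict (xnode_map \<phi>) (X_verts G S) v}
        \<in> edges (X_graph H S')"
      if "u \<in> verts (X_graph G S)" "v \<in> verts (X_graph G S)" "{u, v} \<in> edges (X_graph G S)"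
      using that xnode_map_edge[OF assms, of "{u, v}"] by (simp add: X_graph_def)
  next
    fix u v
    show "{xnode_map g u, xnode_map g v} \<in> edges (X_graph G S)"
      if "u \<in> verts (X_graph H S')" "v \<in> verts (X_graph H S')" "{u, v} \<in> edges (X_graph H S')"
      using that swap.xnode_map_edge[OF g, of "{u, v}"] by (simp add: X_graph_def)
  qed (simp_all add: X_graph_def vert inv1 inv2 xnode_map_color[OF assms])
qed

end

subsection \<open>From graph isomorphisms to series isomorphisms\<close>

locale X_graph_isomorphism = composition_series_pair +
  fixes f
  assumes f: "f \<in> graph_Iso (X_graph G S) (X_graph H S')"
begin

lemma f_bij: "bij_betw f (X_verts G S) (X_verts H S')"
  and f_extensional: "f \<in> extensional (X_verts G S)"
  and f_edge: "u \<in> X_verts G S \<Longrightarrow> v \<in> X_verts G S \<Longrightarrow>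
        {f u, f v} \<in> X_edges H S' \<longleftrightarrow> {u, v} \<in> X_edges G S"
  and f_color: "v \<in> X_verts G S \<Longrightarrow> X_color H (f v) = X_color G v"
  using f by (auto simp: graph_Iso_def X_graph_def)

lemma f_closed: "v \<in> X_verts G S \<Longrightarrow> f v \<in> X_verts H S'"
  using f_bij by (rule bij_betwE[THEN bspec])

lemma f_eq_iff: "u \<in> X_verts G S \<Longrightarrow> v \<in> X_verts G S \<Longrightarrow> f u = f v \<longleftrightarrow> u = v"
  using f_bij by (auto simp: bij_betw_def inj_on_def)

lemma skeleton_vert: "v \<in> G.skeleton \<Longrightarrow> v \<in> X_verts G S"
  by (simp add: G.skeleton_def)

lemma f_skeleton: "v \<in> G.skeleton \<Longrightarrow> f v \<in> H.skeleton"
  using f_closed f_color by (auto simp: G.skeleton_def H.skeleton_def)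

text \<open>The root is the unique vertex of its color.\<close>

lemma f_root: "f (Main (carrier G)) = Main (carrier H)"
proof -
  have "Main (carrier G) \<in> X_verts G S"
    using G.carrier_in_tree G.Main_in_skeleton_iff skeleton_vert by blast
  from f_color[OF this] show ?thesis using H.X_color_Root_iff by simp
qed

text \<open>Adjacency is unordered, so the orientation of the image edge stays open until levels are
  known to be preserved.\<close>

lemma f_parent_or:
  assumes "G.parent u v"
  shows "H.parent (f u) (f v) \<or> H.parent (f v) (f u)"
proof -
  note p = G.parentD(1,2)[OF assms]
  have "{u, v} \<in> X_edges G S" using assms G.X_edge_skeleton_iff[OF p] by simp
  then have "{f u, f v} \<in> X_edges H S'" using f_edge p skeleton_vert by simp
  then show ?thesis using H.X_edge_skeleton_iff f_skeleton p by simp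
qed

text \<open>Follow the path from the root to v: its image starts at the root, and each edge changes
  the level by one in either direction, so it cannot descend faster than the path itself.\<close>

lemma f_level_le: "v \<in> G.skeleton \<Longrightarrow> H.level (f v) \<le> G.level v"
proof (induction "G.level v" arbitrary: v)
  case 0
  then have "v = Main (carrier G)" using G.level_0_iff by simp
  then show ?case using f_root by (simp add: H.level_Main H.height_carrier)
next
  case (Suc k)
  then obtain u where u: "G.parent u v" using G.parent_exists by (metis zero_less_Suc)
  note p = G.parentD[OF u]
  have "H.level (f v) \<le> Suc (H.level (f u))" 
    using f_parent_or[OF u] H.parentD(3) by fastforce
  also have "\<dots> \<le> G.level v" using Suc p by simp
  finally show ?case .
qed

text \<open>Apply \<open>f_level_le\<close> to f and to its inverse, which is again a colored
  isomorphism.\<close>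

lemma f_level: assumes "v \<in> G.skeleton" shows "H.level (f v) = G.level v"
proof -
  define g where "g = restrict (inv_into (X_verts G S) f) (X_verts H S')"
  interpret inv: X_graph_isomorphism H S' G S g
    using graph_Iso_inverse[OF f]
    by (intro X_graph_isomorphism.intro[OF swap] X_graph_isomorphism_axioms.intro)
      (simp add: g_def X_graph_def)
  have "g (f v) = v"
    using f_bij skeleton_vert[OF assms] f_closed by (simp add: g_def bij_betw_inv_into_left)
  then show ?thesis
    using f_level_le[OF assms] inv.f_level_le[OF f_skeleton[OF assms]] by simp
qed

lemma f_skeleton_surj:
  assumes "w \<in> H.skeleton"
  shows "\<exists>v \<in> G.skeleton. f v = w"
proof -
  have "w \<in> f ` X_verts G S" using f_bij assms by (simp add: bij_betw_def H.skeleton_def)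
  then obtain v where v: "v \<in> X_verts G S" "f v = w" by blast
  then have "v \<in> G.skeleton" using f_color[OF v(1)] assms by (simp add: G.skeleton_def H.skeleton_def)
  then show ?thesis using v by blast
qed

lemma f_parent: assumes "G.parent u v" shows "H.parent (f u) (f v)"
proof -
  note p = G.parentD[OF assms]
  show ?thesis
    using f_parent_or[OF assms] H.parentD(3)[of "f v" "f u"] f_level[OF p(1)] f_level[OF p(2)] p(3) by auto
qed

text \<open>The deepest skeleton level is twice the length of the series, attained at the leaf of
  the identity in the copy at the identity. The image of this leaf in one graph and the preimage of
  its counterpart in the other give the two inequalities.\<close>

lemma m_eq_of_graph_Iso: "G.m = H.m"
proof -
  have "G.level (copy_node G \<one>\<^bsub>G\<^esub> {\<one>\<^bsub>G\<^esub>}) = 2 * G.m"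
    by (simp add: G.level_copy_node G.height_singleton)
  moreover have "copy_node G \<one>\<^bsub>G\<^esub> {\<one>\<^bsub>G\<^esub>} \<in> G.skeleton"
    by (simp add: G.copy_node_in_skeleton G.singleton_in_tree)
  ultimately have 1: "2 * G.m \<le> 2 * H.m" using f_level f_skeleton H.level_le by metis
  obtain v where v: "v \<in> G.skeleton" "f v = copy_node H \<one>\<^bsub>H\<^esub> {\<one>\<^bsub>H\<^esub>}"
    using f_skeleton_surj H.copy_node_in_skeleton H.singleton_in_tree H.one_closed by metis
  then have "G.level v = 2 * H.m"
    using f_level[OF v(1)] by (simp add: H.level_copy_node H.height_singleton)
  then show ?thesis using 1 G.level_le[OF v(1)] by simp
qed

text \<open>Induction from the root downwards: as \<open>parent\<close> is preserved, the image of a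
  child is a child of the image, and above the glued leaves these stay in
  \<open>T_S\<close>.\<close>

lemma f_Main:
  assumes "C \<in> tree_nodes G S"
  shows "\<exists>D \<in> tree_nodes H S'. f (Main C) = Main D \<and> H.height D = G.height C"
  using assms
proof (induction "G.m - G.height C" arbitrary: C)
  case 0
  then have "C = carrier G" using G.cosets_at_height[of C] G.height_mD by simp
  then show ?case
    using f_root H.carrier_in_tree by (simp add: G.height_carrier H.height_carrier m_eq_of_graph_Iso)
next
  case (Suc k)
  then obtain B where B: "(B, C) \<in> tree_edges G S" using G.tree_edge_parent by force
  note BC = G.tree_edgeD[OF B]
  obtain B' where B': "B' \<in> tree_nodes H S'" "f (Main B) = Main B'" "H.height B' = G.height B"
    using Suc(1)[of B] Suc(2) BC(1,3) by fastforce
  have "H.parent (Main B') (f (Main C))" using f_parent[OF G.parent_Main[OF B]] B' by simp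
  \<comment> \<open>B has a child, so its height is positive, and \<open>B'\<close> has the same
    height; thus \<open>Main B'\<close> is not a copy root.\<close>
  moreover have "H.level (Main B') < H.m" using B' BC m_eq_of_graph_Iso by (simp add: H.level_Main)
  ultimately obtain D where D: "f (Main C) = Main D" "(B', D) \<in> tree_edges H S'"
    using H.parent_Main_cases by blast
  then show ?case using H.tree_edgeD[OF D(2)] B' BC by auto
qed

section \<open>The map on elements and the images of tree vertices\<close>

definition \<phi> where
  "\<phi> = (\<lambda>x\<in>carrier G. THE y. f (Main {x}) = Main {y})"

text \<open>Heights are preserved, so a singleton goes to a node of height 0, again a singleton.
  This justifies the description in \<open>\<phi>\<close>.\<close>

lemma f_Main_singleton:
  assumes "x \<in> carrier G"
  shows "f (Main {x}) = Main {\<phi> x}" "\<phi> x \<in> carrier H"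
proof -
  obtain D where D: "D \<in> tree_nodes H S'" "f (Main {x}) = Main D" "H.height D = 0"
    using f_Main[OF G.singleton_in_tree[OF assms]] assms by (auto simp: G.height_singleton)
  then obtain y where y: "y \<in> carrier H" "D = {y}" using H.height_0D by blast
  then have "\<phi> x = y" using D assms by (simp add: \<phi>_def)
  then show "f (Main {x}) = Main {\<phi> x}" "\<phi> x \<in> carrier H" using y D by auto
qed

lemma \<phi>_bij: "bij_betw \<phi> (carrier G) (carrier H)"
proof (rule bij_betw_imageI)
  have vert: "Main {x} \<in> X_verts G S" if "x \<in> carrier G" for x
    using that G.singleton_in_tree G.Main_in_skeleton_iff skeleton_vert by blast
  show "inj_on \<phi> (carrier G)"
  proof (rule inj_onI)
    fix x y assume xy: "x \<in> carrier G" "y \<in> carrier G" "\<phi> x = \<phi> y"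
    then have "f (Main {x}) = f (Main {y})" using f_Main_singleton by simp
    then show "x = y" using f_eq_iff[OF vert[OF xy(1)] vert[OF xy(2)]] by simp
  qed
  show "\<phi> ` carrier G = carrier H"
  proof
    show "carrier H \<subseteq> \<phi> ` carrier G"
    proof
      fix y assume y: "y \<in> carrier H"
      then obtain v where v: "v \<in> G.skeleton" "f v = Main {y}"
        using f_skeleton_surj H.Main_in_skeleton_iff H.singleton_in_tree by metis
      \<comment> \<open>A preimage of a vertex at level \<open>m\<close> lies at level
        \<open>m\<close> too, where all vertices are glued leaves.\<close>
      then have "G.level v = G.m"
        using f_level[OF v(1)] y m_eq_of_graph_Iso by (simp add: H.level_Main H.height_singleton)
      then obtain x where "x \<in> carrier G" "v = Main {x}" using G.level_m[OF v(1)] by blast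
      then show "y \<in> \<phi> ` carrier G" using v f_Main_singleton[of x] by auto
    qed
  qed (use f_Main_singleton in auto)
qed

text \<open>The induction of \<open>f_Main\<close>, started at the root \<open>Main {x}\<close> of
  the copy, whose image is the root of the copy at \<open>\<phi> x\<close>.\<close>

lemma f_copy_node:
  assumes "x \<in> carrier G" "C \<in> tree_nodes G S"
  shows "\<exists>D \<in> tree_nodes H S'. f (copy_node G x C) = copy_node H (\<phi> x) D \<and> H.height D = G.height C"
  using assms(2)
proof (induction "G.m - G.height C" arbitrary: C)
  case 0
  then have "C = carrier G" using G.cosets_at_height[of C] G.height_mD by simp
  then show ?case
    using f_Main_singleton[OF assms(1)] H.carrier_in_tree
    by (intro bexI[of _ "carrier H"])
      (simp_all add: copy_node_def G.height_carrier H.height_carrier m_eq_of_graph_Iso)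
next
  case (Suc k)
  then obtain B where B: "(B, C) \<in> tree_edges G S" using G.tree_edge_parent by force
  note BC = G.tree_edgeD[OF B]
  obtain B' where B': "B' \<in> tree_nodes H S'" "f (copy_node G x B) = copy_node H (\<phi> x) B'"
      "H.height B' = G.height B"
    using Suc(1)[of B] Suc(2) BC(1,3) by fastforce
  have "H.parent (copy_node H (\<phi> x) B') (f (copy_node G x C))"
    using f_parent[OF G.parent_copy_node[OF B assms(1)]] B' by simp
  then obtain D where D: "f (copy_node G x C) = copy_node H (\<phi> x) D" "(B', D) \<in> tree_edges H S'"
    using H.parent_copy_node_cases f_Main_singleton(2)[OF assms(1)] by blast
  then show ?case using H.tree_edgeD[OF D(2)] B' BC by auto
qed

text \<open>Injectivity of \<open>k\<close> upgrades \<open>\<phi> ` C \<subseteq> k C\<close>, which follows by climbing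
  from the leaves, to an equality.\<close>

lemma tree_map_eq_image:
  assumes node: "\<And>C. C \<in> tree_nodes G S \<Longrightarrow> k C \<in> tree_nodes H S' \<and> H.height (k C) = G.height C"
    and edge: "\<And>C D. (C, D) \<in> tree_edges G S \<Longrightarrow> k D \<subseteq> k C"
    and inj: "inj_on k (tree_nodes G S)"
    and leaf: "\<And>x. x \<in> carrier G \<Longrightarrow> k {x} = {\<phi> x}"
    and C: "C \<in> tree_nodes G S"
  shows "k C = \<phi> ` C"
proof
  have mem: "\<phi> x \<in> k C" if "C \<in> tree_nodes G S" "x \<in> C" for x C
    using that
  proof (induction "G.height C" arbitrary: C)
    case 0
    then show ?case using G.height_0D[of C] leaf by auto
  next
    case (Suc i)
    then obtain D where D: "(C, D) \<in> tree_edges G S" "x \<in> D" using G.tree_edge_child by force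
    then have "\<phi> x \<in> k D" using Suc(1)[of D] Suc(2) G.tree_edgeD[OF D(1)] by simp
    then show ?case using edge[OF D(1)] by blast
  qed
  show "\<phi> ` C \<subseteq> k C" using mem[OF C] by blast
  show "k C \<subseteq> \<phi> ` C"
  proof
    fix y assume y: "y \<in> k C"
    then have "y \<in> carrier H" using node[OF C] H.tree_node_subset by blast
    then obtain x where x: "x \<in> carrier G" "y = \<phi> x" using \<phi>_bij by (auto simp: bij_betw_def)
    \<comment> \<open>Compare C with the node D of the same height through the preimage x of y.
      Their images have equal height and share y, so they agree, and injectivity of k gives D = C,
      which contains x.\<close>
    obtain D where D': "D \<in> G.cosets_at (G.height C)" "x \<in> D"
      using G.coset_through[OF x(1)] G.cosets_at_height[OF C] by blast
    then have D: "D \<in> tree_nodes G S" "G.height D = G.height C" "x \<in> D"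
      using G.cosets_at_height[OF C] G.height_eq[OF D'(1)] by (auto simp: G.tree_nodes_iff)
    have "k D = k C"
      using H.tree_node_eq[of "k D" "k C" y] node[OF C] node[OF D(1)] D mem[OF D(1,3)] x y by simp
    then have "D = C" using inj C D(1) by (auto simp: inj_on_def)
    then show "y \<in> \<phi> ` C" using D x by blast
  qed
qed

lemma f_Main_eq_image:
  assumes "C \<in> tree_nodes G S"
  shows "f (Main C) = Main (\<phi> ` C)"
proof -
  \<comment> \<open>Choose the target nodes provided by \<open>f_Main\<close> as one function, so
    that \<open>tree_map_eq_image\<close> applies.\<close>
  obtain k where k: "\<And>C. C \<in> tree_nodes G S \<Longrightarrow>
      k C \<in> tree_nodes H S' \<and> f (Main C) = Main (k C) \<and> H.height (k C) = G.height C"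
    using f_Main by metis
  have "k C = \<phi> ` C"
  proof (rule tree_map_eq_image)
    fix C D assume CD: "(C, D) \<in> tree_edges G S"
    note t = G.tree_edgeD[OF CD]
    have "H.parent (Main (k C)) (Main (k D))" using f_parent[OF G.parent_Main[OF CD]] k t by simp
    moreover have "H.level (Main (k C)) < H.m" using k t m_eq_of_graph_Iso by (simp add: H.level_Main)
    ultimately show "k D \<subseteq> k C" using H.parent_Main_cases H.tree_edgeD(5) by blast
  next
    show "inj_on k (tree_nodes G S)"
    proof (rule inj_onI)
      fix C D assume CD: "C \<in> tree_nodes G S" "D \<in> tree_nodes G S" "k C = k D"
      then have "f (Main C) = f (Main D)" using k by simp
      then show "C = D" using CD f_eq_iff G.Main_in_skeleton_iff skeleton_vert by simp
    qed
  next
    show "k {x} = {\<phi> x}" if "x \<in> carrier G" for x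
      using k[OF G.singleton_in_tree[OF that]] f_Main_singleton[OF that] by simp
  qed (simp_all add: k assms)
  then show ?thesis using k[OF assms] by simp
qed

text \<open>A priori each copy may be mapped by its own bijection of leaves; this is the one for the
  copy at x. It is shown below to agree with \<open>\<phi>\<close>.\<close>

definition \<psi> where
  "\<psi> x y = (THE z. f (copy_node G x {y}) = copy_node H (\<phi> x) {z})"

lemma f_copy_node_singleton:
  assumes "x \<in> carrier G" "y \<in> carrier G"
  shows "f (copy_node G x {y}) = copy_node H (\<phi> x) {\<psi> x y}" "\<psi> x y \<in> carrier H"
proof -
  obtain D where D: "D \<in> tree_nodes H S'" "f (copy_node G x {y}) = copy_node H (\<phi> x) D" "H.height D = 0"
    using f_copy_node[OF assms(1) G.singleton_in_tree[OF assms(2)]] assms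
    by (auto simp: G.height_singleton)
  then obtain z where z: "z \<in> carrier H" "D = {z}" using H.height_0D by blast
  then have "\<psi> x y = z" using D by (simp add: \<psi>_def H.copy_node_inject)
  then show "f (copy_node G x {y}) = copy_node H (\<phi> x) {\<psi> x y}" "\<psi> x y \<in> carrier H"
    using z D by auto
qed

section \<open>Pendant leaves and the group law\<close>

lemma leaf_vert:
  assumes "x \<in> carrier G" "y \<in> carrier G"
  shows "LeftLeaf x y \<in> X_verts G S" "RightLeaf x y \<in> X_verts G S" "EqualLeaf x y \<in> X_verts G S"
  using assms by (auto simp: X_verts_def)

text \<open>The color fixes the kind of the image leaf, and its unique skeleton neighbour, the image
  of \<open>copy_node G x {y}\<close>, fixes both arguments.\<close>

lemma f_leaf_aux:
  assumes "x \<in> carrier G" "y \<in> carrier G"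
  shows "f (LeftLeaf x y) = LeftLeaf (\<phi> x) (\<psi> x y)"
    "f (RightLeaf x y) = RightLeaf (\<phi> x) (\<psi> x y)"
    "f (EqualLeaf x y) = EqualLeaf (\<phi> x) (\<psi> x y)"
proof -
  note lv = leaf_vert[OF assms]
  have cv: "copy_node G x {y} \<in> G.skeleton"
    using assms G.copy_node_in_skeleton G.singleton_in_tree by blast
  have edge: "{copy_node H (\<phi> x) {\<psi> x y}, f l} \<in> X_edges H S'"
    if "l \<in> X_verts G S" "{copy_node G x {y}, l} \<in> X_edges G S" for l
    using f_edge[OF skeleton_vert[OF cv] that(1)] that(2) f_copy_node_singleton[OF assms] by simp
  have ch: "copy_node H (\<phi> x) {\<psi> x y} \<in> H.skeleton"
    using f_skeleton[OF cv] f_copy_node_singleton[OF assms] by simp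
  have leafD: "\<phi> x = a \<and> \<psi> x y = b" if "copy_node H (\<phi> x) {\<psi> x y} = copy_node H a {b}" for a b
    using that by (simp add: H.copy_node_inject)
  have verts: "a \<in> carrier H \<and> b \<in> carrier H"
    if "LeftLeaf a b \<in> X_verts H S' \<or> RightLeaf a b \<in> X_verts H S' \<or> EqualLeaf a b \<in> X_verts H S'" for a b
    using that by (auto simp: X_verts_def copy_node_def split: if_splits)
  note e = edge[OF lv(1) X_edges_intros(3)[OF assms]] edge[OF lv(2) X_edges_intros(4)[OF assms]]
    edge[OF lv(3) X_edges_intros(5)[OF assms]]
  show "f (LeftLeaf x y) = LeftLeaf (\<phi> x) (\<psi> x y)"
  proof -
    obtain a b where ab: "f (LeftLeaf x y) = LeftLeaf a b"
      using f_color[OF lv(1)] by (cases "f (LeftLeaf x y)") (auto split: if_splits)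
    have "a \<in> carrier H" "b \<in> carrier H" using verts[of a b] f_closed[OF lv(1)] ab by auto
    then show ?thesis using H.skeleton_leaf_edge_iff(1)[OF ch] e(1) leafD ab by auto
  qed
  show "f (RightLeaf x y) = RightLeaf (\<phi> x) (\<psi> x y)"
  proof -
    obtain a b where ab: "f (RightLeaf x y) = RightLeaf a b"
      using f_color[OF lv(2)] by (cases "f (RightLeaf x y)") (auto split: if_splits)
    have "a \<in> carrier H" "b \<in> carrier H" using verts[of a b] f_closed[OF lv(2)] ab by auto
    then show ?thesis using H.skeleton_leaf_edge_iff(2)[OF ch] e(2) leafD ab by auto
  qed
  show "f (EqualLeaf x y) = EqualLeaf (\<phi> x) (\<psi> x y)"
  proof -
    obtain a b where ab: "f (EqualLeaf x y) = EqualLeaf a b"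
      using f_color[OF lv(3)] by (cases "f (EqualLeaf x y)") (auto split: if_splits)
    have "a \<in> carrier H" "b \<in> carrier H" using verts[of a b] f_closed[OF lv(3)] ab by auto
    then show ?thesis using H.skeleton_leaf_edge_iff(3)[OF ch] e(3) leafD ab by auto
  qed
qed

text \<open>The edge from \<open>LeftLeaf x y\<close> to \<open>RightLeaf y x\<close> exchanges copy
  and leaf. In its image, the leaf \<open>\<psi> x y\<close> must therefore match the copy index
  \<open>\<phi> y\<close>.\<close>

lemma \<psi>_eq_\<phi>:
  assumes "x \<in> carrier G" "y \<in> carrier G"
  shows "\<psi> x y = \<phi> y"
proof -
  have "{f (LeftLeaf x y), f (RightLeaf y x)} \<in> X_edges H S'"
    using f_edge[OF leaf_vert(1)[OF assms] leaf_vert(2)[OF assms(2,1)]] X_edges_intros(6)[OF assms]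
    by simp
  then show ?thesis
    using H.leaf_leaf_edge_iff(1)[OF f_Main_singleton(2)[OF assms(1)] f_copy_node_singleton(2)[OF assms]]
      f_leaf_aux[OF assms] f_leaf_aux[OF assms(2,1)] by simp
qed

lemma f_leaf:
  assumes "x \<in> carrier G" "y \<in> carrier G"
  shows "f (LeftLeaf x y) = LeftLeaf (\<phi> x) (\<phi> y)"
    "f (RightLeaf x y) = RightLeaf (\<phi> x) (\<phi> y)"
    "f (EqualLeaf x y) = EqualLeaf (\<phi> x) (\<phi> y)"
  using f_leaf_aux[OF assms] \<psi>_eq_\<phi>[OF assms] by auto

text \<open>The right-equal edge of the product xy is mapped to an edge, whose equal leaf lies in
  the copy at \<open>\<phi>\<close> of the product; by \<open>leaf_leaf_edge_iff\<close> that copy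
  index is the product of the images.\<close>

lemma \<phi>_mult:
  assumes "x \<in> carrier G" "y \<in> carrier G"
  shows "\<phi> (x \<otimes>\<^bsub>G\<^esub> y) = \<phi> x \<otimes>\<^bsub>H\<^esub> \<phi> y"
proof -
  have xy: "x \<otimes>\<^bsub>G\<^esub> y \<in> carrier G" using assms by simp
  have "{f (RightLeaf y x), f (EqualLeaf (x \<otimes>\<^bsub>G\<^esub> y) y)} \<in> X_edges H S'"
    using f_edge[OF leaf_vert(2)[OF assms(2,1)] leaf_vert(3)[OF xy assms(2)]]
      X_edges_intros(7)[OF assms] by simp
  then show ?thesis
    using H.leaf_leaf_edge_iff(2)[OF f_Main_singleton(2)[OF assms(1)] f_Main_singleton(2)[OF assms(2)]]
      f_leaf[OF assms(2,1)] f_leaf[OF xy assms(2)] by simp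
qed

text \<open>As for \<open>f_Main_eq_image\<close>, within one copy. The condition on leaves is
  supplied by \<open>\<psi>_eq_\<phi>\<close>.\<close>

lemma f_copy_node_eq_image:
  assumes x: "x \<in> carrier G" and "C \<in> tree_nodes G S"
  shows "f (copy_node G x C) = copy_node H (\<phi> x) (\<phi> ` C)"
proof -
  obtain k where k: "\<And>C. C \<in> tree_nodes G S \<Longrightarrow>
      k C \<in> tree_nodes H S' \<and> f (copy_node G x C) = copy_node H (\<phi> x) (k C) \<and> H.height (k C) = G.height C"
    using f_copy_node[OF x] by metis
  have "k C = \<phi> ` C"
  proof (rule tree_map_eq_image)
    fix C D assume CD: "(C, D) \<in> tree_edges G S"
    note t = G.tree_edgeD[OF CD]
    have "H.parent (copy_node H (\<phi> x) (k C)) (copy_node H (\<phi> x) (k D))"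
      using f_parent[OF G.parent_copy_node[OF CD x]] k t by simp
    then show "k D \<subseteq> k C"
      using H.parent_copy_node_cases[OF _ f_Main_singleton(2)[OF x]] H.tree_edgeD(5) H.copy_node_inject
      by metis
  next
    show "inj_on k (tree_nodes G S)"
    proof (rule inj_onI)
      fix C D assume CD: "C \<in> tree_nodes G S" "D \<in> tree_nodes G S" "k C = k D"
      then have "f (copy_node G x C) = f (copy_node G x D)" using k by simp
      then show "C = D"
        using f_eq_iff[OF skeleton_vert[OF G.copy_node_in_skeleton[OF x CD(1)]]
            skeleton_vert[OF G.copy_node_in_skeleton[OF x CD(2)]]] G.copy_node_inject by simp
    qed
  next
    show "k {y} = {\<phi> y}" if "y \<in> carrier G" for y
      using k[OF G.singleton_in_tree[OF that]] f_copy_node_singleton[OF x that] \<psi>_eq_\<phi>[OF x that]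
      by (simp add: H.copy_node_inject)
  qed (simp_all add: k assms)
  then show ?thesis using k[OF assms(2)] by simp
qed

lemma \<phi>_series_Iso: "\<phi> \<in> series_Iso G S H S'"
proof -
  have hom: "\<phi> \<in> hom G H" using f_Main_singleton(2) \<phi>_mult by (auto simp: hom_def)
  then have one: "\<phi> \<one>\<^bsub>G\<^esub> = \<one>\<^bsub>H\<^esub>"
    using G.is_group H.is_group hom_one by blast
  have "\<phi> ` (S ! i) = S' ! i" if "i < length S" for i
  proof -
    have i: "i \<le> G.m" "i \<le> H.m" using that G.length_S m_eq_of_graph_Iso by auto
    have C: "S ! i \<in> tree_nodes G S" "G.height (S ! i) = i"
      using G.S_coset[OF i(1)] i G.tree_nodes_iff G.height_eq by auto
    have D: "S' ! i \<in> tree_nodes H S'" "H.height (S' ! i) = i"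
      using H.S_coset[OF i(2)] i H.tree_nodes_iff H.height_eq by auto
    \<comment> \<open>As a set, the image is the node that f assigns to \<open>S ! i\<close>, hence
      a coset of H_i; containing the identity, it is H_i itself.\<close>
    have E: "\<phi> ` (S ! i) \<in> tree_nodes H S'" "H.height (\<phi> ` (S ! i)) = i"
      using f_Main[OF C(1)] f_Main_eq_image[OF C(1)] C by auto
    have "\<one>\<^bsub>G\<^esub> \<in> S ! i" "\<one>\<^bsub>H\<^esub> \<in> S' ! i"
      using G.subgroup_S[OF i(1)] H.subgroup_S[OF i(2)] subgroup.one_closed by auto
    moreover from this one have "\<one>\<^bsub>H\<^esub> \<in> \<phi> ` (S ! i)" by (metis imageI)
    ultimately show ?thesis
      using H.tree_node_eq[OF E(1) D(1), of "\<one>\<^bsub>H\<^esub>"] D E by simp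
  qed
  moreover have "\<phi> \<in> extensional (carrier G)" by (simp add: \<phi>_def)
  moreover have "length S = length S'" using m_eq_of_graph_Iso G.length_S H.length_S by simp
  ultimately show ?thesis using hom \<phi>_bij by (auto simp: series_Iso_def iso_def)
qed

text \<open>The vertex kinds are covered by the preceding lemmas, and off the vertex set both sides
  are undefined by extensionality. This yields surjectivity of the correspondence.\<close>

lemma f_eq_xnode_map: "f = restrict (xnode_map \<phi>) (X_verts G S)"
proof
  fix v
  show "f v = restrict (xnode_map \<phi>) (X_verts G S) v"
  proof (cases "v \<in> X_verts G S")
    case False
    then show ?thesis using f_extensional by (simp add: extensional_def)
  next
    case True
    then have "f v = xnode_map \<phi> v"
      unfolding X_verts_def
      by (elim UnE UN_E CollectE exE conjE imageE insertE emptyE)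
        (simp_all add: f_Main_eq_image f_copy_node_eq_image xnode_map_copy_node[OF \<phi>_series_Iso] f_leaf)
    then show ?thesis using True by simp
  qed
qed

end

lemma (in composition_series_pair) xnode_map_bij_betw:
  "bij_betw (\<lambda>\<phi>. restrict (xnode_map \<phi>) (X_verts G S))
     (series_Iso G S H S') (graph_Iso (X_graph G S) (X_graph H S'))"
proof (rule bij_betw_imageI)
  let ?F = "\<lambda>\<phi>. restrict (xnode_map \<phi>) (X_verts G S)"
  show "inj_on ?F (series_Iso G S H S')"
  proof (rule inj_onI)
    fix \<phi> \<psi> assume \<phi>: "\<phi> \<in> series_Iso G S H S'" and \<psi>: "\<psi> \<in> series_Iso G S H S'" and eq: "?F \<phi> = ?F \<psi>"
    show "\<phi> = \<psi>"
    proof (rule extensionalityI[where A = "carrier G"])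
      fix x assume x: "x \<in> carrier G"
      \<comment> \<open>The value at x can be read off from the glued leaf of x, which gives
        injectivity.\<close>
      have "Main {x} \<in> X_verts G S" using G.singleton_in_tree[OF x] by (simp add: X_verts_def)
      then show "\<phi> x = \<psi> x" using fun_cong[OF eq, of "Main {x}"] by simp
    qed (use \<phi> \<psi> in \<open>auto simp: series_Iso_def\<close>)
  qed
  show "?F ` series_Iso G S H S' = graph_Iso (X_graph G S) (X_graph H S')"
  proof
    show "graph_Iso (X_graph G S) (X_graph H S') \<subseteq> ?F ` series_Iso G S H S'"
    proof
      fix f assume "f \<in> graph_Iso (X_graph G S) (X_graph H S')"
      then interpret X_graph_isomorphism G S H S' f by unfold_locales
      show "f \<in> ?F ` series_Iso G S H S'" using f_eq_xnode_map \<phi>_series_Iso by blast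
    qed
  qed (use xnode_map_graph_Iso in blast)
qed

theorem theorem9:
  fixes G :: "('a, 'm) monoid_scheme" and H :: "('b, 'n) monoid_scheme"
    and S :: "'a set list" and S' :: "'b set list"
  assumes "group G" and "finite (carrier G)"
    and "group H" and "finite (carrier H)"
    and "composition_series G S"
    and "composition_series H S'"
  shows "\<exists>\<Psi>. bij_betw \<Psi> (series_Iso G S H S') (graph_Iso (X_graph G S) (X_graph H S'))"
proof -
  interpret composition_series_pair G S H S'
    using assms
    by (simp add: composition_series_pair_def composition_series_group_def
        composition_series_group_axioms_def)
  show ?thesis using xnode_map_bij_betw by blast
qed

end
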